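(* Let $\zeta$ be an aperiodic and primitive constant-shape substitution with expansion matrix $L_{\zeta}$ and support $F_{1}^{\zeta}$. Then there exists a constant $c>0$ such that for all $r\ge 1$, $$p_{\zeta}(r)\leq c\cdot r^{-\log(|\det(L_\zeta)|)/\log(\Vert L_\zeta^{-1}\Vert)},$$ where $p_\zeta(r)$ is the number of patterns with support $B(0,r)\cap\mathbb{Z}^d$ occurring in points of $X_\zeta$.
   Context: Fix $d\ge 1$; $\|\cdot\|$ is the Euclidean norm on $\mathbb{R}^d$ and the induced operator norm on matrices; $B(0,r)$ is the Euclidean ball. An integer $d\times d$ matrix $L$ is an expansion matrix if there is $\lambda>1$ with $\|Lx\|>\lambda\|x\|$ for all $x\in\mathbb{R}^d\setminus\{0\}$. A fundamental domain of $L(\mathbb{Z}^d)$ in $\mathbb{Z}^d$ is a set containing exactly one representative of each class of $\mathbb{Z}^d/L(\mathbb{Z}^d)$; it is always taken to contain $0$. For a finite alphabet $\mathcal A$, $\mathbb{Z}^d$ acts on $\mathcal A^{\mathbb{Z}^d}$ by $S^{n}(x)_{k}=x_{n+k}$. A pattern is an element of $\mathcal A^P$ with $P\subset\mathbb{Z}^d$ finite; it occurs in $x$ (or in a larger pattern) if it equals, up to translation of its support, a restriction of it. A constant-shape substitution with expansion matrix $L=L_\zeta$ and support $F_1=F_1^\zeta$ (a fundamental domain of $L(\mathbb{Z}^d)$ in $\mathbb{Z}^d$) is a map $\zeta:\mathcal A\to\mathcal A^{F_1}$. Put $F_{n+1}=L(F_n)+F_1$; the iterates $\zeta^n:\mathcal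 A\to\mathcal A^{F_n}$ are defined by $\zeta^1=\zeta$ and $\zeta^{n+1}(a)_{L(j)+f}=\zeta(\zeta^n(a)_j)_f$ for $j\in F_n$, $f\in F_1$. $X_\zeta\subseteq \mathcal A^{\mathbb{Z}^d}$ is the set of all $x$ such that every pattern occurring in $x$ occurs in $\zeta^n(a)$ for some $n>0$, $a\in\mathcal A$. $\zeta$ is primitive if there is $n>0$ such that for all $a,b\in\mathcal A$, $b$ occurs in $\zeta^n(a)$. $\zeta$ is aperiodic if $S^px=x$ with $x\in X_\zeta$, $p\in\mathbb{Z}^d$, implies $p=0$. Standing assumption: the sequence of supports $(F_n)_{n>0}$ is Følner, i.e. $|F_n\Delta(m+F_n)|/|F_n|\to0$ for every $m\in\mathbb{Z}^d$. *)

theory Defs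
  imports "HOL-Analysis.Analysis"
begin

definition real_vec :: "int ^ 'd \<Rightarrow> real ^ 'd" where
  "real_vec k = (\<chi> i. real_of_int (k $ i))"

abbreviation real_mat :: "int ^ 'd ^ 'd \<Rightarrow> real ^ 'd ^ 'd" where
  "real_mat L \<equiv> map_matrix real_of_int L"

abbreviation op_norm :: "real ^ 'd ^ 'd \<Rightarrow> real" where
  "op_norm A \<equiv> onorm ((*v) A)"

definition expansion_matrix :: "int ^ 'd ^ 'd \<Rightarrow> bool" where
  "expansion_matrix L \<longleftrightarrow>
     (\<exists>l>1. \<forall>x. x \<noteq> 0 \<longrightarrow> norm (real_mat L *v x) > l * norm x)"

definition fundamental_domain :: "int ^ 'd ^ 'd \<Rightarrow> (int ^ 'd) set \<Rightarrow> bool" where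
  "fundamental_domain L F \<longleftrightarrow> 0 \<in> F \<and> (\<forall>k. \<exists>!f. f \<in> F \<and> k - f \<in> range ((*v) L))"

(* Patterns are partial maps with finite domain, the domain being the support.  The second
   argument is a larger pattern, or a point x of the full shift written as "Some \<circ> x". *)
definition occurs :: "(int ^ 'd \<rightharpoonup> 'a) \<Rightarrow> (int ^ 'd \<rightharpoonup> 'a) \<Rightarrow> bool" where
  "occurs p y \<longleftrightarrow> (\<exists>m. p \<subseteq>\<^sub>m (\<lambda>k. y (k + m)))"

definition shift :: "int ^ 'd \<Rightarrow> ((int ^ 'd) \<Rightarrow> 'a) \<Rightarrow> ((int ^ 'd) \<Rightarrow> 'a)" where
  "shift n x = (\<lambda>k. x (n + k))"

definition constant_shape_substitution ::
  "int ^ 'd ^ 'd \<Rightarrow> (int ^ 'd) set \<Rightarrow> ('a \<Rightarrow> int ^ 'd \<rightharpoonup> 'a) \<Rightarrow> bool" where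
  "constant_shape_substitution L F \<zeta> \<longleftrightarrow>
     expansion_matrix L \<and> fundamental_domain L F \<and> (\<forall>a. dom (\<zeta> a) = F)"

(* The recursions below start at n = 0, with a single letter at the origin; the values at n = 1
   are F and \<zeta> (lemmas supports_1 and subst_iter_1). *)
fun supports :: "int ^ 'd ^ 'd \<Rightarrow> (int ^ 'd) set \<Rightarrow> nat \<Rightarrow> (int ^ 'd) set" where
  "supports L F 0 = {0}"
| "supports L F (Suc n) = {L *v j + f | j f. j \<in> supports L F n \<and> f \<in> F}"

definition folner :: "(nat \<Rightarrow> (int ^ 'd) set) \<Rightarrow> bool" where
  "folner F \<longleftrightarrow>
     (\<forall>m. (\<lambda>n. real (card (sym_diff (F n) ((+) m ` F n))) / real (card (F n))) \<longlonglongrightarrow> 0)"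

(* Over a fundamental domain F every k has a unique decomposition k = L *v j + f with f in F. *)
definition decomp :: "int ^ 'd ^ 'd \<Rightarrow> (int ^ 'd) set \<Rightarrow> (int ^ 'd) \<Rightarrow> (int ^ 'd) \<times> (int ^ 'd)" where
  "decomp L F k = (THE (j, f). f \<in> F \<and> k = L *v j + f)"

fun subst_iter ::
  "int ^ 'd ^ 'd \<Rightarrow> (int ^ 'd) set \<Rightarrow> ('a \<Rightarrow> int ^ 'd \<rightharpoonup> 'a) \<Rightarrow> nat \<Rightarrow> 'a \<Rightarrow> int ^ 'd \<rightharpoonup> 'a" where
  "subst_iter L F \<zeta> 0 a = [0 \<mapsto> a]"
| "subst_iter L F \<zeta> (Suc n) a =
     (\<lambda>k. let (j, f) = decomp L F k in Option.bind (subst_iter L F \<zeta> n a j) (\<lambda>b. \<zeta> b f))"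

definition subst_shift ::
  "int ^ 'd ^ 'd \<Rightarrow> (int ^ 'd) set \<Rightarrow> ('a \<Rightarrow> int ^ 'd \<rightharpoonup> 'a) \<Rightarrow> ((int ^ 'd) \<Rightarrow> 'a) set" where
  "subst_shift L F \<zeta> =
     {x. \<forall>p. finite (dom p) \<and> occurs p (Some \<circ> x)
           \<longrightarrow> (\<exists>n>0. \<exists>a. occurs p (subst_iter L F \<zeta> n a))}"

definition primitive_subst ::
  "int ^ 'd ^ 'd \<Rightarrow> (int ^ 'd) set \<Rightarrow> ('a \<Rightarrow> int ^ 'd \<rightharpoonup> 'a) \<Rightarrow> bool" where
  "primitive_subst L F \<zeta> \<longleftrightarrow> (\<exists>n>0. \<forall>a b. b \<in> ran (subst_iter L F \<zeta> n a))"

definition aperiodic_subst ::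
  "int ^ 'd ^ 'd \<Rightarrow> (int ^ 'd) set \<Rightarrow> ('a \<Rightarrow> int ^ 'd \<rightharpoonup> 'a) \<Rightarrow> bool" where
  "aperiodic_subst L F \<zeta> \<longleftrightarrow> (\<forall>x \<in> subst_shift L F \<zeta>. \<forall>p. shift p x = x \<longrightarrow> p = 0)"

(* The closed ball is used; the count for the open ball of the same radius is at most this one. *)
definition lattice_ball :: "real \<Rightarrow> (int ^ 'd) set" where
  "lattice_ball r = {k. real_vec k \<in> cball 0 r}"

definition ball_patterns ::
  "int ^ 'd ^ 'd \<Rightarrow> (int ^ 'd) set \<Rightarrow> ('a \<Rightarrow> int ^ 'd \<rightharpoonup> 'a) \<Rightarrow> real \<Rightarrow> (int ^ 'd \<rightharpoonup> 'a) set" where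
  "ball_patterns L F \<zeta> r =
     {p. dom p = lattice_ball r \<and> (\<exists>x \<in> subst_shift L F \<zeta>. occurs p (Some \<circ> x))}"

definition complexity ::
  "int ^ 'd ^ 'd \<Rightarrow> (int ^ 'd) set \<Rightarrow> ('a \<Rightarrow> int ^ 'd \<rightharpoonup> 'a) \<Rightarrow> real \<Rightarrow> nat" where
  "complexity L F \<zeta> r = card (ball_patterns L F \<zeta> r)"

lemma real_vec_mult: "real_vec (L *v k) = real_mat L *v real_vec k"
  by (simp add: real_vec_def matrix_vector_mult_def vec_eq_iff)

lemma expansion_matrix_inj:
  assumes "expansion_matrix L" and "L *v j = L *v k"
  shows "j = k"
proof (rule ccontr)
  assume "j \<noteq> k"
  then have "real_vec j - real_vec k \<noteq> 0"
    by (auto simp: real_vec_def vec_eq_iff)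
  moreover have "real_mat L *v (real_vec j - real_vec k) = 0"
    by (simp add: matrix_vector_mult_diff_distrib assms(2) flip: real_vec_mult)
  ultimately obtain l where "l > 1" "0 > l * norm (real_vec j - real_vec k)"
    using assms(1) unfolding expansion_matrix_def by (metis norm_zero)
  then show False
    by (smt (verit) mult_nonneg_nonneg norm_ge_zero)
qed

lemma decomp_eq:
  assumes "constant_shape_substitution L F \<zeta>" and "f \<in> F"
  shows "decomp L F (L *v j + f) = (j, f)"
  unfolding decomp_def
proof (rule the_equality)
  fix p assume p: "case p of (j', f') \<Rightarrow> f' \<in> F \<and> L *v j + f = L *v j' + f'"
  obtain j' f' where [simp]: "p = (j', f')" by (cases p)
  have e: "f' \<in> F" "L *v j + f = L *v j' + f'" using p by auto
  have "L *v j + f - f \<in> range ((*v) L)" by simp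
  moreover have "L *v j + f - f' \<in> range ((*v) L)" using e by simp
  ultimately have "f = f'"
    using assms e(1) unfolding constant_shape_substitution_def fundamental_domain_def by blast
  with e assms show "p = (j, f)"
    by (auto simp: constant_shape_substitution_def dest: expansion_matrix_inj)
qed (use assms in auto)

lemma decomp_exists:
  assumes "constant_shape_substitution L F \<zeta>"
  obtains j f where "f \<in> F" "k = L *v j + f"
proof -
  obtain f where "f \<in> F" "k - f \<in> range ((*v) L)"
    using assms unfolding constant_shape_substitution_def fundamental_domain_def by blast
  then show ?thesis using that by (metis diff_add_cancel imageE)
qed

lemma supports_1: "supports L F 1 = F"
  by simp

lemma subst_iter_step:
  assumes "constant_shape_substitution L F \<zeta>" and "f \<in> F"
  shows "subst_iter L F \<zeta> (Suc n) a (L *v j + f)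
           = Option.bind (subst_iter L F \<zeta> n a j) (\<lambda>b. \<zeta> b f)"
  using decomp_eq[OF assms] by simp

lemma subst_iter_dom:
  assumes "constant_shape_substitution L F \<zeta>"
  shows "dom (subst_iter L F \<zeta> n a) = supports L F n"
proof (induction n)
  case (Suc n)
  have d: "dom (\<zeta> b) = F" for b
    using assms by (simp add: constant_shape_substitution_def)
  have "k \<in> dom (subst_iter L F \<zeta> (Suc n) a) \<longleftrightarrow> k \<in> supports L F (Suc n)" for k
  proof -
    obtain j f where jf: "f \<in> F" "k = L *v j + f" using decomp_exists[OF assms] .
    have "k \<in> dom (subst_iter L F \<zeta> (Suc n) a) \<longleftrightarrow> j \<in> dom (subst_iter L F \<zeta> n a)"
      unfolding jf(2) domIff subst_iter_step[OF assms jf(1)]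
      using d jf(1) by (cases "subst_iter L F \<zeta> n a j") auto
    also have "\<dots> \<longleftrightarrow> k \<in> supports L F (Suc n)"
      using decomp_eq[OF assms] jf by (auto simp: Suc.IH) (metis Pair_inject)
    finally show ?thesis .
  qed
  then show ?case by blast
qed (auto split: if_splits)

lemma subst_iter_1:
  assumes "constant_shape_substitution L F \<zeta>"
  shows "subst_iter L F \<zeta> 1 a = \<zeta> a"
proof
  fix k
  have d: "dom (\<zeta> a) = F"
    using assms by (simp add: constant_shape_substitution_def)
  show "subst_iter L F \<zeta> 1 a k = \<zeta> a k"
  proof (cases "k \<in> F")
    case True
    then show ?thesis using subst_iter_step[OF assms True, of 0 a 0] by simp
  next
    case False
    then show ?thesis
      using subst_iter_dom[OF assms, of 1 a] d by (metis domIff supports_1)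
  qed
qed

lemma finite_lattice_ball: "finite (lattice_ball r :: (int ^ 'd::finite) set)"
proof -
  let ?B = "{- \<lceil>r\<rceil>..\<lceil>r\<rceil>}"
  have "lattice_ball r \<subseteq> vec_lambda ` (UNIV \<rightarrow>\<^sub>E ?B :: ('d \<Rightarrow> int) set)"
  proof
    fix k :: "int ^ 'd" assume "k \<in> lattice_ball r"
    then have n: "norm (real_vec k) \<le> r" by (simp add: lattice_ball_def)
    have "\<bar>real_of_int (k $ i)\<bar> \<le> r" for i
      using component_le_norm_cart[of "real_vec k" i] n by (simp add: real_vec_def)
    then have "k $ i \<in> ?B" for i
      using le_of_int_ceiling[of r] by (smt (verit) atLeastAtMost_iff of_int_le_iff of_int_minus)
    then show "k \<in> vec_lambda ` (UNIV \<rightarrow>\<^sub>E ?B)"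
      by (intro image_eqI[of _ _ "vec_nth k"]) (auto simp: vec_lambda_eta)
  qed
  then show ?thesis
    by (rule finite_subset) (auto intro!: finite_imageI finite_PiE)
qed

lemma finite_ball_patterns:
  "finite (ball_patterns L F (\<zeta> :: 'a::finite \<Rightarrow> (int ^ 'd::finite) \<rightharpoonup> 'a) r)"
  by (rule finite_subset[OF _ finite_set_of_finite_maps[OF finite_lattice_ball[of r] finite[of UNIV]]])
     (auto simp: ball_patterns_def)

end

theory Submission
  imports Defs "HOL-Combinatorics.Permutations"
begin

text \<open>Given \<open>r\<close>, choose \<open>n\<close> minimal with \<open>\<alpha>^n r \<le> 1\<close>, where \<open>\<alpha> < 1\<close> is the norm of the inverse
  of \<open>L\<close>. By primitivity, every pattern on the ball of radius \<open>r\<close> occurs in some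
  \<open>\<zeta>^m(a) = \<zeta>^n(\<zeta>^(m-n)(a))\<close> with \<open>m \<ge> n\<close>. It is therefore determined by its position relative to
  the tiling by translates of \<open>F_n\<close>, for which there are at most \<open>|F|^n\<close> choices, and by the letters
  of \<open>\<zeta>^(m-n)(a)\<close> on a set whose diameter is bounded independently of \<open>r\<close>. A volume comparison
  gives \<open>|F| \<le> |det L|\<close>, and \<open>|det L|^n\<close> is at most \<open>|det L|\<close> times the power of \<open>r\<close> claimed.\<close>

section \<open>Invertibility of an expansion matrix and the norm of its inverse\<close>

lemma real_vec_diff: "real_vec (a - b) = real_vec a - real_vec b"
  by (simp add: real_vec_def vec_eq_iff)

lemma matrix_inv_invertible:
  assumes "invertible A"
  shows "A ** matrix_inv A = mat 1" "matrix_inv A ** A = mat 1"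
proof -
  have "A ** matrix_inv A = mat 1 \<and> matrix_inv A ** A = mat 1"
    using assms unfolding invertible_def matrix_inv_def by (rule someI_ex)
  then show "A ** matrix_inv A = mat 1" "matrix_inv A ** A = mat 1" by auto
qed

lemma expansion_matrix_invertible:
  assumes "expansion_matrix L"
  shows "invertible (real_mat L)"
proof -
  obtain l where l: "l > 1" "\<And>x. x \<noteq> 0 \<Longrightarrow> norm (real_mat L *v x) > l * norm x"
    using assms unfolding expansion_matrix_def by blast
  have "x = 0" if "real_mat L *v x = 0" for x
    using l(2)[of x] that \<open>l > 1\<close> by (smt (verit) mult_nonneg_nonneg norm_ge_zero norm_zero)
  then show ?thesis
    by (simp add: invertible_left_inverse matrix_left_invertible_injective vec.inj_iff_eq_0)
qed

lemmas expansion_matrix_inv = matrix_inv_invertible[OF expansion_matrix_invertible]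

text \<open>Putting x = L^(-1) y into the expansion inequality with constant l bounds the norm of
  the inverse by 1/l. It is nonzero because the inverse sends L(1) back to the all-ones vector 1.
  Together the two bounds make the logarithm in the denominator of the exponent negative.\<close>

lemma op_norm_inv_expansion:
  assumes "expansion_matrix (L :: int ^ 'd::finite ^ 'd)"
  shows "0 < op_norm (matrix_inv (real_mat L))" "op_norm (matrix_inv (real_mat L)) < 1"
proof -
  let ?M = "matrix_inv (real_mat L)"
  have bl: "bounded_linear ((*v) ?M)"
    by (simp add: linear_linear)
  have Linv: "real_mat L *v (?M *v y) = y" and invL: "?M *v (real_mat L *v y) = y" for y
    by (simp_all add: matrix_vector_mul_assoc expansion_matrix_inv[OF assms])
  obtain l where l: "l > 1" "\<And>x. x \<noteq> 0 \<Longrightarrow> norm (real_mat L *v x) > l * norm x"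
    using assms unfolding expansion_matrix_def by blast
  have "norm (?M *v y) \<le> (1 / l) * norm y" for y
    using l(2)[of "?M *v y"] l(1) by (cases "?M *v y = 0") (auto simp: Linv field_simps)
  then have "op_norm ?M \<le> 1 / l"
    by (rule onorm_le)
  moreover have "1 / l < 1" using l(1) by simp
  ultimately show "op_norm ?M < 1"
    by (rule le_less_trans)
  have "?M *v (real_mat L *v 1) \<noteq> 0"
    by (simp add: invL)
  then show "0 < op_norm ?M"
    using onorm_pos_lt[OF bl] by blast
qed

section \<open>Determinants under relabelling of coordinates\<close>

text \<open>\<open>measure_linear_image\<close> is available only for index types of class \<open>wellorder\<close>; the following
  copy of a finite type has that class.\<close>

typedef 'a ranked = "UNIV :: 'a set" by simp

instantiation ranked :: (finite) "{finite, wellorder}"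
begin

text \<open>The order is pulled back along the injection \<open>to_nat\<close>, so it is total and
  inherits well-foundedness from the naturals.\<close>

definition less_eq_ranked :: "'a ranked \<Rightarrow> 'a ranked \<Rightarrow> bool" where
  "x \<le> y \<longleftrightarrow> to_nat (Rep_ranked x) \<le> to_nat (Rep_ranked y)"

definition less_ranked :: "'a ranked \<Rightarrow> 'a ranked \<Rightarrow> bool" where
  "x < y \<longleftrightarrow> to_nat (Rep_ranked x) < to_nat (Rep_ranked y)"

instance
proof
  fix P :: "'a ranked \<Rightarrow> bool" and x
  assume step: "\<And>x. (\<And>y. y < x \<Longrightarrow> P y) \<Longrightarrow> P x"
  show "P x"
    by (induction x rule: measure_induct_rule[of "\<lambda>x. to_nat (Rep_ranked x)"])
      (auto intro: step simp: less_ranked_def)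
next
  show "finite (UNIV :: 'a ranked set)"
    by (rule finite_imageD[of Rep_ranked]) (auto simp: inj_on_def Rep_ranked_inject)
qed (auto simp: less_eq_ranked_def less_ranked_def Rep_ranked_inject)

end

lemma bij_Rep_ranked: "bij Rep_ranked"
  by (metis Rep_ranked_inject bijI injI UNIV_I Abs_ranked_inverse surjI)

text \<open>Conjugation by h, which is \<open>?m\<close>, is a sign-preserving bijection between the
  permutations of the two index types, and it matches the terms of the two Leibniz sums.\<close>

lemma det_reindex:
  fixes A :: "'a::comm_ring_1 ^ 'n::finite ^ 'n" and h :: "'m::finite \<Rightarrow> 'n"
  assumes h: "bij h"
  shows "det (\<chi> i j. A $ h i $ h j) = det A"
proof -
  let ?m = "map_permutation UNIV h"
  have inj: "inj h" using h by (rule bij_is_inj)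
  have bb: "bij_betw ?m {p. p permutes UNIV} {p. p permutes UNIV}"
  proof (rule bij_betw_byWitness[where f' = "map_permutation UNIV (inv h)"])
    show "\<forall>p\<in>{p. p permutes UNIV}. map_permutation UNIV (inv h) (?m p) = p"
      using map_permutation_compose_inv[OF h] inj by auto
    show "\<forall>p\<in>{p. p permutes UNIV}. ?m (map_permutation UNIV (inv h) p) = p"
      using map_permutation_compose_inv[OF bij_imp_bij_inv[OF h]] h
      by (auto simp: bij_is_surj surj_f_inv_f)
    show "?m ` {p. p permutes UNIV} \<subseteq> {p. p permutes UNIV}"
      using map_permutation_permutes[OF h] by auto
    show "map_permutation UNIV (inv h) ` {p. p permutes UNIV} \<subseteq> {p. p permutes UNIV}"
      using map_permutation_permutes[OF bij_imp_bij_inv[OF h]] by auto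
  qed
  have "det A = (\<Sum>p | p permutes UNIV. of_int (sign (?m p)) * (\<Prod>i\<in>UNIV. A $ i $ ?m p i))"
    unfolding det_def by (rule sum.reindex_bij_betw[OF bb, symmetric])
  also have "\<dots> = (\<Sum>p | p permutes UNIV. of_int (sign p) * (\<Prod>i\<in>UNIV. A $ h i $ h (p i)))"
  proof (rule sum.cong[OF refl])
    fix p :: "'m \<Rightarrow> 'm" assume "p \<in> {p. p permutes UNIV}"
    moreover have "(\<Prod>i\<in>UNIV. A $ i $ ?m p i) = (\<Prod>i\<in>UNIV. A $ h i $ ?m p (h i))"
      by (rule prod.reindex_bij_betw[OF h, symmetric])
    ultimately show "of_int (sign (?m p)) * (\<Prod>i\<in>UNIV. A $ i $ ?m p i) =
        of_int (sign p) * (\<Prod>i\<in>UNIV. A $ h i $ h (p i))"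
      using sign_map_permutation[OF inj] by (simp add: map_permutation_apply[OF inj])
  qed
  finally show ?thesis by (simp add: det_def)
qed

section \<open>Volume comparison and the size of a fundamental domain\<close>

text \<open>The cube is half-open so that its integer translates partition space exactly, with no
  overlap on faces.\<close>

definition unit_cell :: "(real ^ 'd) set" where
  "unit_cell = {x. \<forall>i. 0 \<le> x $ i \<and> x $ i < 1}"

lemma unit_cell_cover: "\<exists>k. x - real_vec k \<in> unit_cell"
proof -
  have "x - real_vec (\<chi> i. \<lfloor>x $ i\<rfloor>) \<in> unit_cell"
    by (auto simp: unit_cell_def real_vec_def) linarith
  then show ?thesis ..
qed

lemma unit_cell_unique:
  assumes "x - real_vec k \<in> unit_cell" "x - real_vec j \<in> unit_cell"
  shows "k = j"
proof -
  have "k $ i = j $ i" for i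
  proof -
    have "0 \<le> x $ i - k $ i" "x $ i - k $ i < 1" "0 \<le> x $ i - j $ i" "x $ i - j $ i < 1"
      using assms by (auto simp: unit_cell_def real_vec_def)
    then show ?thesis by linarith
  qed
  then show ?thesis by (simp add: vec_eq_iff)
qed

text \<open>The cell is a finite intersection of half-spaces, hence Borel, and lies between the open
  and the closed unit cube, which both have volume 1.\<close>

lemma unit_cell_measure:
  "(unit_cell :: (real ^ 'd::finite) set) \<in> lmeasurable"
  "measure lebesgue (unit_cell :: (real ^ 'd) set) = 1"
proof -
  let ?Q = "unit_cell :: (real ^ 'd) set"
  have sub: "box 0 1 \<subseteq> ?Q" "?Q \<subseteq> cbox 0 1"
    by (auto simp: unit_cell_def mem_box_cart less_imp_le)
  have "?Q = (\<Inter>i. {x. 0 \<le> x $ i} \<inter> {x. x $ i < 1})"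
    by (auto simp: unit_cell_def)
  also have "\<dots> \<in> sets borel"
    by (intro sets.countable_INT'' sets.Int borel_closed borel_open
        closed_halfspace_component_ge_cart open_halfspace_component_lt_cart) auto
  finally have "?Q \<in> sets borel" .
  then show Q: "?Q \<in> lmeasurable"
    using sub(2) bounded_cbox bounded_subset bounded_set_imp_lmeasurable
    by (metis sets_completionI_sets sets_lborel)
  have one: "measure lebesgue (cbox 0 (1 :: real ^ 'd)) = 1"
    by (simp add: content_cbox_cart interval_eq_empty_cart)
  have two: "measure lebesgue (box 0 (1 :: real ^ 'd)) = 1"
    using one by (simp add: measure_lborel_box_eq measure_lborel_cbox_eq split: if_splits)
  have "measure lebesgue (box 0 (1 :: real ^ 'd)) \<le> measure lebesgue ?Q"
    by (rule measure_mono_fmeasurable[OF sub(1)]) (use Q in auto)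
  moreover have "measure lebesgue ?Q \<le> measure lebesgue (cbox 0 (1 :: real ^ 'd))"
    by (rule measure_mono_fmeasurable[OF sub(2)]) (use Q in \<open>auto simp: fmeasurableD\<close>)
  ultimately show "measure lebesgue ?Q = 1"
    using one two by simp
qed

lemma emeasure_lebesgue_translation:
  "emeasure lebesgue ((+) a ` S) = emeasure lebesgue (S :: 'a::euclidean_space set)"
  using emeasure_lebesgue_affine[of 1 a S] by (simp add: add.commute[of _ a])

text \<open>Both the parallelepiped spanned by the columns of \<open>L\<close> and the union of the unit cells at
  the points of a fundamental domain tile space under the translations by \<open>L(Z^d)\<close>.\<close>

lemma card_inequivalent_le_det_wellorder:
  fixes L :: "int ^ 'd::{finite,wellorder} ^ 'd::_"
  assumes L: "invertible (real_mat L)" and fin: "finite G"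
    and ineq: "\<And>f g. f \<in> G \<Longrightarrow> g \<in> G \<Longrightarrow> f - g \<in> range ((*v) L) \<Longrightarrow> f = g"
  shows "real (card G) \<le> \<bar>det (real_mat L)\<bar>"
proof -
  let ?L = "(*v) (real_mat L)"
  have injL: "inj ?L"
    using L by (simp add: invertible_left_inverse matrix_left_invertible_injective)
  define P where "P = ?L ` unit_cell"
  have P: "P \<in> lmeasurable" and mP: "measure lebesgue P = \<bar>det (real_mat L)\<bar>"
    unfolding P_def
    by (simp_all add: unit_cell_measure measurable_linear_image measure_linear_image)
  have Pcover: "\<exists>k. x - real_vec (L *v k) \<in> P" for x
  proof -
    obtain y where y: "x = real_mat L *v y"
      by (metis L matrix_inv_invertible(1) matrix_vector_mul_assoc matrix_vector_mul_lid)
    obtain k where "y - real_vec k \<in> unit_cell" using unit_cell_cover by blast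
    then have "x - real_vec (L *v k) \<in> P"
      unfolding P_def y real_vec_mult by (metis imageI matrix_vector_mult_diff_distrib)
    then show ?thesis ..
  qed
  have Punique: "k = j" if kj: "x - real_vec (L *v k) \<in> P" "x - real_vec (L *v j) \<in> P" for x k j
  proof -
    obtain y z where y: "y \<in> unit_cell" "x - real_vec (L *v k) = real_mat L *v y"
      and z: "z \<in> unit_cell" "x - real_vec (L *v j) = real_mat L *v z"
      using kj unfolding P_def by auto
    have "real_mat L *v (y + real_vec k) = real_mat L *v (z + real_vec j)"
      using y(2) z(2) by (simp add: matrix_vector_right_distrib real_vec_mult algebra_simps)
    then have "y + real_vec k = z + real_vec j"
      using injL by (simp add: inj_eq)
    then have "y + real_vec k - real_vec j \<in> unit_cell"
      using z(1) by simp
    moreover have "y + real_vec k - real_vec k \<in> unit_cell"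
      using y(1) by simp
    ultimately show ?thesis
      by (metis unit_cell_unique)
  qed
  \<comment> \<open>\<open>A f k\<close> is the part of the unit cell at f that lies in the tile L k
    + P; \<open>B f k\<close> is the same part moved back into P by -L k.\<close>
  define A where "A f k = (+) (real_vec f) ` unit_cell \<inter> (+) (real_vec (L *v k)) ` P" for f k
  define B where "B f k = (+) (real_vec (f - L *v k)) ` unit_cell \<inter> P" for f k
  have memA: "x \<in> A f k \<longleftrightarrow> x - real_vec f \<in> unit_cell \<and> x - real_vec (L *v k) \<in> P" for x f k
    unfolding A_def by (auto simp: image_iff) (metis add_diff_cancel_left' diff_add_cancel add.commute)+
  have memB: "x \<in> B f k \<longleftrightarrow> x - real_vec (f - L *v k) \<in> unit_cell \<and> x \<in> P" for x f k
    unfolding B_def by (auto simp: image_iff) (metis diff_add_cancel add.commute)+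
  have AB: "A f k = (+) (real_vec (L *v k)) ` B f k" for f k
  proof (intro set_eqI)
    fix x
    have "x \<in> (+) (real_vec (L *v k)) ` B f k \<longleftrightarrow> x - real_vec (L *v k) \<in> B f k"
      by (auto simp: image_iff) (metis diff_add_cancel add.commute)
    then show "x \<in> A f k \<longleftrightarrow> x \<in> (+) (real_vec (L *v k)) ` B f k"
      by (simp add: memA memB real_vec_diff algebra_simps)
  qed
  have meas[measurable]: "A f k \<in> sets lebesgue" "B f k \<in> sets lebesgue" for f k
    unfolding A_def B_def using P unit_cell_measure(1)
    by (auto intro!: sets.Int measurable_translation fmeasurableD)
  have real_inj: "k = j" if "L *v k = L *v j" for k j
  proof -
    have "real_vec k = real_vec j"
      using that injL by (metis injD real_vec_mult)
    then show ?thesis by (simp add: real_vec_def vec_eq_iff)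
  qed
  \<comment> \<open>A common point lies in the integer cells at f - L k and g - L j. These cells
    coincide, so f and g are congruent modulo L(Z^d).\<close>
  have Bdisj: "f = g \<and> k = j" if "f \<in> G" "g \<in> G" "x \<in> B f k" "x \<in> B g j" for f g k j x
  proof -
    have e: "f - L *v k = g - L *v j"
      using that unit_cell_unique by (auto simp: memB)
    then have "f - g = L *v (k - j)"
      by (simp add: matrix_vector_mult_diff_distrib algebra_simps)
    then have "f = g" using ineq that by blast
    with e show ?thesis using real_inj by auto
  qed
  define BU where "BU f = (\<Union>k. B f k)" for f
  have BU_sets: "BU f \<in> sets lebesgue" for f
    unfolding BU_def by (intro sets.countable_UN') auto
  \<comment> \<open>Cutting the cell at f along the tiling by translates of P and moving all pieces
    into P preserves its volume 1.\<close>
  have BU_meas: "emeasure lebesgue (BU f) = 1" if "f \<in> G" for f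
  proof -
    have "emeasure lebesgue (BU f) = (\<integral>\<^sup>+k. emeasure lebesgue (B f k) \<partial>count_space UNIV)"
      unfolding BU_def using Bdisj that
      by (intro emeasure_UN_countable) (auto simp: disjoint_family_on_def)
    also have "\<dots> = (\<integral>\<^sup>+k. emeasure lebesgue (A f k) \<partial>count_space UNIV)"
      by (simp add: AB emeasure_lebesgue_translation)
    also have "\<dots> = emeasure lebesgue (\<Union>k. A f k)"
      by (intro emeasure_UN_countable[symmetric])
        (use Punique in \<open>auto simp: disjoint_family_on_def memA\<close>)
    also have "(\<Union>k. A f k) = (+) (real_vec f) ` unit_cell"
      using Pcover by (auto simp: A_def image_iff) (metis diff_add_cancel add.commute)
    also have "emeasure lebesgue \<dots> = 1"
      by (simp add: unit_cell_measure emeasure_lebesgue_translation emeasure_eq_measure2)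
    finally show ?thesis .
  qed
  \<comment> \<open>The sets \<open>BU f\<close> are disjoint subsets of P of volume 1, so their
    number is at most the volume of P.\<close>
  have "of_nat (card G) = (\<Sum>f\<in>G. emeasure lebesgue (BU f))"
    by (simp add: BU_meas)
  also have "\<dots> = emeasure lebesgue (\<Union>f\<in>G. BU f)"
    using Bdisj fin BU_sets by (intro sum_emeasure) (auto simp: disjoint_family_on_def BU_def)
  also have "\<dots> \<le> emeasure lebesgue P"
    using P by (intro emeasure_mono) (auto simp: BU_def memB)
  also have "\<dots> = ennreal \<bar>det (real_mat L)\<bar>"
    using P mP by (simp add: emeasure_eq_measure2)
  finally show ?thesis
    by (simp add: ennreal_of_nat_eq_real_of_nat)
qed

text \<open>Relabelling coordinates by \<open>e\<close> intertwines L with \<open>L'\<close>, so it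
  preserves incongruence, and \<open>det_reindex\<close> shows that the determinant does not
  change.\<close>

lemma card_inequivalent_le_det:
  fixes L :: "int ^ 'd::finite ^ 'd"
  assumes L: "invertible (real_mat L)" and fin: "finite G"
    and ineq: "\<And>f g. f \<in> G \<Longrightarrow> g \<in> G \<Longrightarrow> f - g \<in> range ((*v) L) \<Longrightarrow> f = g"
  shows "real (card G) \<le> \<bar>det (real_mat L)\<bar>"
proof -
  let ?h = "Rep_ranked :: 'd ranked \<Rightarrow> 'd"
  define L' :: "int ^ 'd ranked ^ 'd ranked" where "L' = (\<chi> i j. L $ ?h i $ ?h j)"
  define e :: "int ^ 'd \<Rightarrow> int ^ 'd ranked" where "e = (\<lambda>v. \<chi> i. v $ ?h i)"
  have e_diff: "e (v - w) = e v - e w" for v w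
    by (simp add: e_def vec_eq_iff)
  have e_inj: "inj e"
    unfolding e_def inj_def vec_eq_iff vec_lambda_beta
    by (metis bij_Rep_ranked bij_is_surj surj_def)
  have e_surj: "\<exists>v. w = e v" for w
    by (rule exI[of _ "\<chi> i. w $ Abs_ranked i"]) (simp add: e_def vec_eq_iff Rep_ranked_inverse)
  have e_mult: "L' *v e v = e (L *v v)" for v
    unfolding e_def L'_def matrix_vector_mult_def vec_eq_iff vec_lambda_beta
    by (intro allI sum.reindex_bij_betw[OF bij_Rep_ranked])
  have "real_mat L' = (\<chi> i j. real_mat L $ ?h i $ ?h j)"
    by (simp add: L'_def map_matrix_def vec_eq_iff)
  then have det: "det (real_mat L') = det (real_mat L)"
    by (simp only: det_reindex[OF bij_Rep_ranked])
  have "real (card (e ` G)) \<le> \<bar>det (real_mat L')\<bar>"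
  proof (rule card_inequivalent_le_det_wellorder)
    show "invertible (real_mat L')"
      using L det by (simp add: invertible_det_nz)
    show "f = g" if fg: "f \<in> e ` G" "g \<in> e ` G" "f - g \<in> range ((*v) L')" for f g
    proof -
      obtain v w where vw: "v \<in> G" "w \<in> G" "f = e v" "g = e w" using fg by blast
      obtain u where "f - g = L' *v e u" using fg(3) e_surj by (metis imageE)
      then have "v - w = L *v u"
        unfolding vw e_mult e_diff[symmetric] using e_inj by (simp add: inj_eq)
      then have "v = w" using ineq vw by blast
      with vw show ?thesis by simp
    qed
  qed (use fin in simp)
  moreover have "card (e ` G) = card G"
    using e_inj by (simp add: card_image inj_on_subset)
  ultimately show ?thesis using det by simp
qed

text \<open>If f - g lies in L(Z^d), then f and g both represent the class of f, so they are equal.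
  The volume bound thus holds for every finite subset of F, which forces F itself to be
  finite.\<close>

lemma fundamental_domain_card:
  fixes L :: "int ^ 'd::finite ^ 'd"
  assumes L: "expansion_matrix L" and F: "fundamental_domain L F"
  shows "finite F" "real (card F) \<le> \<bar>det (real_mat L)\<bar>"
proof -
  have ineq: "f = g" if "f \<in> F" "g \<in> F" "f - g \<in> range ((*v) L)" for f g
  proof -
    have "f - f \<in> range ((*v) L)"
      by (metis diff_self matrix_vector_mult_0_right rangeI)
    with that F show ?thesis unfolding fundamental_domain_def by blast
  qed
  have le: "real (card G) \<le> \<bar>det (real_mat L)\<bar>" if "finite G" "G \<subseteq> F" for G
    using that by (intro card_inequivalent_le_det[OF expansion_matrix_invertible[OF L]]) (auto intro: ineq)
  show "finite F"
  proof (rule ccontr)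
    assume "infinite F"
    then obtain G where "finite G" "G \<subseteq> F" "card G = Suc (nat \<lceil>\<bar>det (real_mat L)\<bar>\<rceil>)"
      using infinite_arbitrarily_large by blast
    with le[of G] show False by linarith
  qed
  then show "real (card F) \<le> \<bar>det (real_mat L)\<bar>" using le by blast
qed

section \<open>Digit expansions in base L and iterated substitutions\<close>

abbreviation mat_iter :: "int ^ 'd ^ 'd \<Rightarrow> nat \<Rightarrow> int ^ 'd \<Rightarrow> int ^ 'd" where
  "mat_iter L n \<equiv> (*v) L ^^ n"

lemma mat_iter_add: "mat_iter L n (j + k) = mat_iter L n j + mat_iter L n k"
  by (induction n) (simp_all add: matrix_vector_right_distrib)

lemma mat_iter_0: "mat_iter L n 0 = 0"
  by (induction n) simp_all

text \<open>This is repeated division by L with remainder in F: the translates of F_n by L^n(Z^d)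
  cover the lattice.\<close>

lemma supports_decomp:
  assumes "constant_shape_substitution L F \<zeta>"
  shows "\<exists>j f. f \<in> supports L F n \<and> k = mat_iter L n j + f"
proof (induction n arbitrary: k)
  case 0
  show ?case by simp
next
  case (Suc n)
  obtain i g where g: "g \<in> F" "k = L *v i + g"
    using decomp_exists[OF assms] .
  obtain j f where f: "f \<in> supports L F n" "i = mat_iter L n j + f"
    using Suc.IH by blast
  have "k = mat_iter L (Suc n) j + (L *v f + g)"
    by (simp add: g(2) f(2) matrix_vector_right_distrib add.assoc)
  moreover have "L *v f + g \<in> supports L F (Suc n)"
    using f(1) g(1) by auto
  ultimately show ?case by blast
qed

text \<open>The recursion applies \<open>\<zeta>\<close> last, so the last digit of f can be removed
  and induction used. This is the identity \<zeta>^(n+m) = \<zeta>^n \<zeta>^m read at one position;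
  outside the support of \<zeta>^m(a) both sides are \<open>None\<close>.\<close>

lemma subst_iter_comp:
  assumes "constant_shape_substitution L F \<zeta>" and "f \<in> supports L F n"
  shows "subst_iter L F \<zeta> (n + m) a (mat_iter L n j + f) =
    Option.bind (subst_iter L F \<zeta> m a j) (\<lambda>b. subst_iter L F \<zeta> n b f)"
  using assms(2)
proof (induction n arbitrary: f)
  case 0
  then show ?case by (cases "subst_iter L F \<zeta> m a j") auto
next
  case (Suc n)
  then obtain f' g where f: "f' \<in> supports L F n" "g \<in> F" "f = L *v f' + g"
    by auto
  have "mat_iter L (Suc n) j + f = L *v (mat_iter L n j + f') + g"
    by (simp add: f(3) matrix_vector_right_distrib add.assoc)
  then have "subst_iter L F \<zeta> (Suc n + m) a (mat_iter L (Suc n) j + f) =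
    Option.bind (subst_iter L F \<zeta> (n + m) a (mat_iter L n j + f')) (\<lambda>b. \<zeta> b g)"
    using subst_iter_step[OF assms(1) f(2)] by (metis add_Suc)
  then show ?case
    unfolding f(3) subst_iter_step[OF assms(1) f(2)] Suc.IH[OF f(1)]
    by (cases "subst_iter L F \<zeta> m a j") auto
qed

lemma card_supports:
  assumes "finite F"
  shows "finite (supports L F n)" "card (supports L F n) \<le> card F ^ n"
proof -
  have "finite (supports L F n) \<and> card (supports L F n) \<le> card F ^ n"
  proof (induction n)
    case (Suc n)
    have e: "supports L F (Suc n) = (\<lambda>(j, f). L *v j + f) ` (supports L F n \<times> F)"
      by auto
    have "card (supports L F (Suc n)) \<le> card (supports L F n \<times> F)"
      unfolding e using Suc assms by (intro card_image_le) auto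
    also have "\<dots> \<le> card F ^ Suc n"
      using Suc by (simp add: card_cartesian_product mult.commute)
    finally show ?case unfolding e using Suc assms by auto
  qed simp
  then show "finite (supports L F n)" "card (supports L F n) \<le> card F ^ n" by auto
qed

text \<open>Writing \<open>\<alpha>\<close> for the norm of the inverse of \<open>L\<close>, a distance \<open>D\<close> contracts to at most
  \<open>\<alpha> * (D + 2 * M)\<close> when both digits in \<open>F\<close> are removed and \<open>L\<close> is inverted.\<close>

lemma quotient_distance:
  fixes L :: "int ^ 'd::finite ^ 'd"
  assumes L: "expansion_matrix L" and M: "\<And>f. f \<in> F \<Longrightarrow> norm (real_vec f) \<le> M"
    and "f \<in> supports L F n" "g \<in> supports L F n"
  defines "\<alpha> \<equiv> op_norm (matrix_inv (real_mat L))"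
  shows "norm (real_vec (j - i)) \<le>
    \<alpha> ^ n * norm (real_vec ((mat_iter L n j + f) - (mat_iter L n i + g))) + 2 * M * (\<Sum>k<n. \<alpha> ^ Suc k)"
  using assms(3,4)
proof (induction n arbitrary: f g)
  case 0
  then show ?case by simp
next
  case (Suc n)
  obtain f' p where f: "f' \<in> supports L F n" "p \<in> F" "f = L *v f' + p"
    using Suc.prems(1) by auto
  obtain g' q where g: "g' \<in> supports L F n" "q \<in> F" "g = L *v g' + q"
    using Suc.prems(2) by auto
  let ?d = "(mat_iter L n j + f') - (mat_iter L n i + g')"
  let ?D = "(mat_iter L (Suc n) j + f) - (mat_iter L (Suc n) i + g)"
  have \<alpha>: "0 \<le> \<alpha>"
    unfolding \<alpha>_def using op_norm_inv_expansion[OF L] by simp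
  have "?D = L *v ?d + (p - q)"
    by (simp add: f(3) g(3) matrix_vector_right_distrib matrix_vector_mult_diff_distrib algebra_simps)
  then have "real_vec ?D - real_vec (p - q) = real_mat L *v real_vec ?d"
    by (metis add_diff_cancel_right' real_vec_diff real_vec_mult)
  then have "real_vec ?d = matrix_inv (real_mat L) *v (real_vec ?D - real_vec (p - q))"
    by (metis L expansion_matrix_inv(2) matrix_vector_mul_assoc matrix_vector_mul_lid)
  then have "norm (real_vec ?d) \<le> \<alpha> * norm (real_vec ?D - real_vec (p - q))"
    unfolding \<alpha>_def by (metis onorm linear_linear matrix_vector_mul_linear)
  moreover have "norm (real_vec ?D - real_vec (p - q)) \<le> norm (real_vec ?D) + 2 * M"
    using M[OF f(2)] M[OF g(2)] norm_triangle_ineq4[of "real_vec ?D" "real_vec (p - q)"]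
      norm_triangle_ineq4[of "real_vec p" "real_vec q"] unfolding real_vec_diff[of p q] by linarith
  ultimately have "norm (real_vec ?d) \<le> \<alpha> * (norm (real_vec ?D) + 2 * M)"
    using \<alpha> by (meson mult_left_mono order_trans)
  \<comment> \<open>The factor \<alpha>^n from the induction hypothesis turns the contribution 2 M
    \<alpha> of the digits p and q into the last summand of the geometric sum.\<close>
  then have "\<alpha> ^ n * norm (real_vec ?d) \<le> \<alpha> ^ n * (\<alpha> * (norm (real_vec ?D) + 2 * M))"
    using \<alpha> by (intro mult_left_mono) auto
  with Suc.IH[OF f(1) g(1)] show ?case
    by (simp add: algebra_simps)
qed

section \<open>Counting the patterns on a ball\<close>

text \<open>By primitivity b occurs in \<zeta>^N(b), so \<zeta>^m'(b) occurs in \<zeta>^(m'+N)(b),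
  and the order can be raised indefinitely. Membership in X only supplies some positive
  order.\<close>

lemma primitive_occurs_later:
  fixes \<zeta> :: "'a::finite \<Rightarrow> int ^ 'd::finite \<rightharpoonup> 'a"
  assumes css: "constant_shape_substitution L F \<zeta>" and "primitive_subst L F \<zeta>"
    and occ: "occurs p (subst_iter L F \<zeta> m a)"
  shows "\<exists>m'\<ge>n. \<exists>b. occurs p (subst_iter L F \<zeta> m' b)"
proof (induction n)
  case 0
  show ?case using occ by blast
next
  case (Suc n)
  then obtain m' b where m': "m' \<ge> n" "occurs p (subst_iter L F \<zeta> m' b)" by blast
  obtain N where N: "N > 0" "\<And>a b. b \<in> ran (subst_iter L F \<zeta> N a)"
    using assms(2) unfolding primitive_subst_def by blast
  obtain j where j: "subst_iter L F \<zeta> N b j = Some b"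
    using N(2)[of b b] by (auto simp: ran_def)
  obtain t where t: "p \<subseteq>\<^sub>m (\<lambda>k. subst_iter L F \<zeta> m' b (k + t))"
    using m'(2) unfolding occurs_def by blast
  \<comment> \<open>The letter b at position j of \<zeta>^N(b) grows into a copy of \<zeta>^m'(b)
    with origin at L^m' j.\<close>
  have "p \<subseteq>\<^sub>m (\<lambda>k. subst_iter L F \<zeta> (m' + N) b (k + (mat_iter L m' j + t)))"
    unfolding map_le_def
  proof
    fix k assume "k \<in> dom p"
    then have e: "p k = subst_iter L F \<zeta> m' b (k + t)"
      using t by (simp add: map_le_def)
    with \<open>k \<in> dom p\<close> have "k + t \<in> supports L F m'"
      using subst_iter_dom[OF css] by (metis domIff)
    from subst_iter_comp[OF css this, of N b j]
    show "p k = subst_iter L F \<zeta> (m' + N) b (k + (mat_iter L m' j + t))"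
      by (simp add: j e algebra_simps)
  qed
  then show ?case
    using m'(1) N(1) unfolding occurs_def by (intro exI[of _ "m' + N"]) auto
qed

text \<open>In the radius defining \<open>U\<close>, the 1 bounds \<alpha>^n r and the rest is the
  full geometric series of digit errors, so \<open>U\<close> depends neither on r nor on n. Its
  elements are partial maps because a ball of coarse positions may stick out of the support of
  \<zeta>^(m-n)(a).\<close>

lemma ball_patterns_card_le:
  fixes L :: "int ^ 'd::finite ^ 'd" and \<zeta> :: "'a::finite \<Rightarrow> int ^ 'd \<rightharpoonup> 'a"
  assumes css: "constant_shape_substitution L F \<zeta>" and prim: "primitive_subst L F \<zeta>"
    and M: "\<And>f. f \<in> F \<Longrightarrow> norm (real_vec f) \<le> M"
  defines "\<alpha> \<equiv> op_norm (matrix_inv (real_mat L))"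
  assumes n: "\<alpha> ^ n * r \<le> 1"
  defines "U \<equiv> {u :: int ^ 'd \<rightharpoonup> 'a. dom u \<subseteq> lattice_ball (1 + 2 * M * (\<alpha> / (1 - \<alpha>)))}"
  shows "finite U" "complexity L F \<zeta> r \<le> card F ^ n * card U"
proof -
  let ?R = "1 + 2 * M * (\<alpha> / (1 - \<alpha>))"
  have L: "expansion_matrix L" and F: "fundamental_domain L F"
    using css by (auto simp: constant_shape_substitution_def)
  have \<alpha>: "0 < \<alpha>" "\<alpha> < 1"
    unfolding \<alpha>_def using op_norm_inv_expansion[OF L] by auto
  have finF: "finite F" using fundamental_domain_card[OF L F] by simp
  have "0 \<in> F" using F by (simp add: fundamental_domain_def)
  then have M0: "0 \<le> M" using M norm_ge_zero order_trans by blast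
  have "U \<subseteq> (\<Union>D\<in>Pow (lattice_ball ?R). {u. dom u = D \<and> ran u \<subseteq> UNIV})"
    by (auto simp: U_def)
  moreover have "finite (\<Union>D\<in>Pow (lattice_ball ?R). {u :: int ^ 'd \<rightharpoonup> 'a. dom u = D \<and> ran u \<subseteq> UNIV})"
    by (intro finite_UN_I finite_set_of_finite_maps)
      (auto simp: finite_lattice_ball intro: finite_subset[OF _ finite_lattice_ball])
  ultimately show finU: "finite U" by (rule finite_subset)
  obtain J f where dec: "f k \<in> supports L F n" "k = mat_iter L n (J k) + f k" for k
    using supports_decomp[OF css, of n] by metis
  \<comment> \<open>\<open>H\<close> rebuilds a pattern from its offset g in F_n and its coarse
    letters u: position k + g has quotient \<open>J (k + g)\<close> and remainder
    \<open>f (k + g)\<close>.\<close>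
  define H where "H = (\<lambda>(g, u :: int ^ 'd \<rightharpoonup> 'a). (\<lambda>k. Option.bind (u (J (k + g)))
      (\<lambda>b. subst_iter L F \<zeta> n b (f (k + g)))) |` lattice_ball r)"
  have geo: "(\<Sum>k<n. \<alpha> ^ Suc k) \<le> \<alpha> / (1 - \<alpha>)"
  proof -
    have "(\<Sum>k<n. \<alpha> ^ Suc k) = \<alpha> * (\<Sum>k<n. \<alpha> ^ k)"
      by (simp add: sum_distrib_left)
    also have "(\<Sum>k<n. \<alpha> ^ k) = (1 - \<alpha> ^ n) / (1 - \<alpha>)"
      using \<alpha> by (simp add: sum_gp_strict)
    also have "\<alpha> * \<dots> \<le> \<alpha> * (1 / (1 - \<alpha>))"
      using \<alpha> by (intro mult_left_mono divide_right_mono) auto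
    finally show ?thesis by simp
  qed
  have "ball_patterns L F \<zeta> r \<subseteq> H ` (supports L F n \<times> U)"
  proof
    fix p assume "p \<in> ball_patterns L F \<zeta> r"
    then obtain x where p: "dom p = lattice_ball r" "x \<in> subst_shift L F \<zeta>" "occurs p (Some \<circ> x)"
      by (auto simp: ball_patterns_def)
    then obtain m0 a0 where "occurs p (subst_iter L F \<zeta> m0 a0)"
      using finite_lattice_ball[of r] unfolding subst_shift_def mem_Collect_eq by metis
    then obtain m a where m: "m \<ge> n" "occurs p (subst_iter L F \<zeta> m a)"
      using primitive_occurs_later[OF css prim] by blast
    then obtain t where t: "p \<subseteq>\<^sub>m (\<lambda>k. subst_iter L F \<zeta> m a (k + t))"
      unfolding occurs_def by blast
    \<comment> \<open>Here t = L^n (J t) + f t. The coarse letters are recentred at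
      \<open>J t\<close>, so that only the remainder \<open>f t\<close> of the position is
      kept.\<close>
    define u where "u = (\<lambda>j. subst_iter L F \<zeta> (m - n) a (J t + j)) |` lattice_ball ?R"
    have "p k = H (f t, u) k" for k
    proof (cases "k \<in> lattice_ball r")
      case False
      then show ?thesis using p(1) by (auto simp: H_def)
    next
      case True
      let ?j = "J (k + f t)" and ?f = "f (k + f t)"
      \<comment> \<open>The point k + f t, with quotient \<open>?j\<close>, is compared with f t,
        which has quotient 0; their difference is k, of norm at most r.\<close>
      have "norm (real_vec (?j - 0)) \<le> \<alpha> ^ n * norm (real_vec ((mat_iter L n ?j + ?f) -
          (mat_iter L n 0 + f t))) + 2 * M * (\<Sum>k<n. \<alpha> ^ Suc k)"
        unfolding \<alpha>_def using dec(1) by (intro quotient_distance[OF L M]) auto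
      moreover have "(mat_iter L n ?j + ?f) - (mat_iter L n 0 + f t) = k"
        using dec(2)[of "k + f t"] by (simp add: mat_iter_0 flip: dec(2)[of "k + f t"])
      moreover have "\<alpha> ^ n * norm (real_vec k) \<le> \<alpha> ^ n * r"
        using True \<alpha> by (intro mult_left_mono) (auto simp: lattice_ball_def)
      moreover have "2 * M * (\<Sum>k<n. \<alpha> ^ Suc k) \<le> 2 * M * (\<alpha> / (1 - \<alpha>))"
        using geo M0 by (intro mult_left_mono) auto
      ultimately have "norm (real_vec ?j) \<le> ?R"
        using n by simp
      then have j: "?j \<in> lattice_ball ?R"
        by (simp add: lattice_ball_def)
      have "k + t = mat_iter L n (J t) + (k + f t)"
        using dec(2)[of t] by (metis add.left_commute)
      also have "\<dots> = mat_iter L n (J t) + (mat_iter L n ?j + ?f)"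
        using dec(2)[of "k + f t"] by simp
      also have "\<dots> = mat_iter L n (J t + ?j) + ?f"
        by (simp add: mat_iter_add add.assoc)
      finally have "subst_iter L F \<zeta> m a (k + t) =
          Option.bind (subst_iter L F \<zeta> (m - n) a (J t + ?j)) (\<lambda>b. subst_iter L F \<zeta> n b ?f)"
        using subst_iter_comp[OF css dec(1)[of "k + f t"], of "m - n" a "J t + ?j"] m(1) by simp
      moreover have "p k = subst_iter L F \<zeta> m a (k + t)"
        using t True p(1) by (auto simp: map_le_def)
      ultimately show ?thesis
        using True j by (simp add: H_def u_def)
    qed
    then have "p = H (f t, u)" by blast
    moreover have "u \<in> U" by (auto simp: u_def U_def)
    ultimately show "p \<in> H ` (supports L F n \<times> U)" using dec(1) by blast
  qed
  then have "complexity L F \<zeta> r \<le> card (supports L F n \<times> U)"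
    unfolding complexity_def using card_supports(1)[OF finF] finU
    by (intro surj_card_le) auto
  also have "\<dots> \<le> card F ^ n * card U"
    using card_supports(2)[OF finF] by (simp add: card_cartesian_product)
  finally show "complexity L F \<zeta> r \<le> card F ^ n * card U" .
qed

section \<open>Choice of n and the final estimate\<close>

theorem proposition3p6:
  fixes L :: "int ^ 'd::finite ^ 'd"
    and F :: "(int ^ 'd) set"
    and \<zeta> :: "'a::finite \<Rightarrow> int ^ 'd \<rightharpoonup> 'a"
  assumes "constant_shape_substitution L F \<zeta>"
    and "folner (supports L F)"
    and "primitive_subst L F \<zeta>"
    and "aperiodic_subst L F \<zeta>"
  shows "\<exists>c>0. \<forall>r\<ge>1. real (complexity L F \<zeta> r) \<le>
           c * r powr (- ln \<bar>det (real_mat L)\<bar> / ln (op_norm (matrix_inv (real_mat L))))"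
proof -
  define \<alpha> where "\<alpha> = op_norm (matrix_inv (real_mat L))"
  define q where "q = \<bar>det (real_mat L)\<bar>"
  have L: "expansion_matrix L" and F: "fundamental_domain L F"
    using assms(1) by (auto simp: constant_shape_substitution_def)
  have \<alpha>: "0 < \<alpha>" "\<alpha> < 1"
    unfolding \<alpha>_def using op_norm_inv_expansion[OF L] by auto
  have finF: "finite F" and cardF: "real (card F) \<le> q"
    unfolding q_def using fundamental_domain_card[OF L F] by auto
  have "F \<noteq> {}" using F by (auto simp: fundamental_domain_def)
  then have q: "1 \<le> q" using cardF finF by (metis card_0_eq less_one linorder_not_le
        of_nat_1 of_nat_le_iff order_trans)
  obtain M where M: "\<And>f. f \<in> F \<Longrightarrow> norm (real_vec f) \<le> M"
    using finite_imp_bounded[OF finite_imageI[OF finF, of real_vec]] by (auto simp: bounded_iff)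
  define U where "U = {u :: int ^ 'd \<rightharpoonup> 'a. dom u \<subseteq> lattice_ball (1 + 2 * M * (\<alpha> / (1 - \<alpha>)))}"
  \<comment> \<open>The factor q pays for rounding s up to n; adding 1 to the size of
    \<open>U\<close> makes the constant visibly positive.\<close>
  have "real (complexity L F \<zeta> r) \<le> (q * (real (card U) + 1)) * r powr (- ln q / ln \<alpha>)"
    if r: "r \<ge> 1" for r
  proof -
    \<comment> \<open>This is the real solution of \<alpha>^s r = 1; it is nonnegative since r is at
      least 1 and \<alpha> is below 1.\<close>
    define s where "s = - ln r / ln \<alpha>"
    define n where "n = nat \<lceil>s\<rceil>"
    have ln\<alpha>: "ln \<alpha> < 0" using \<alpha> by simp
    have "0 \<le> s" unfolding s_def using r ln\<alpha> by (simp add: divide_nonneg_neg divide_nonpos_neg)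
    then have n: "s \<le> real n" "real n \<le> s + 1" unfolding n_def by linarith+
    have "\<alpha> ^ n * r = exp (real n * ln \<alpha> + ln r)"
      using \<alpha> r by (simp add: exp_add exp_of_nat_mult)
    moreover have "real n * ln \<alpha> \<le> s * ln \<alpha>"
      using n(1) ln\<alpha> by (intro mult_right_mono_neg) auto
    moreover have "s * ln \<alpha> = - ln r" using ln\<alpha> by (simp add: s_def)
    ultimately have "\<alpha> ^ n * r \<le> 1" by simp
    then have "complexity L F \<zeta> r \<le> card F ^ n * card U"
      unfolding U_def \<alpha>_def
      using ball_patterns_card_le(2)[OF assms(1,3) M, of n r] by blast
    then have "real (complexity L F \<zeta> r) \<le> real (card F) ^ n * real (card U)"
      by (metis of_nat_le_iff of_nat_mult of_nat_power)
    also have "\<dots> \<le> q powr (s + 1) * (real (card U) + 1)"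
    proof (rule mult_mono)
      have "real (card F) ^ n \<le> q ^ n" using cardF by (intro power_mono) auto
      also have "\<dots> = q powr real n" using q by (simp add: powr_realpow)
      also have "\<dots> \<le> q powr (s + 1)" using n q by (intro powr_mono) auto
      finally show "real (card F) ^ n \<le> q powr (s + 1)" .
    qed auto
    \<comment> \<open>Both q^s and the claimed power of r equal exp(- ln q * ln r / ln
      \<alpha>).\<close>
    also have "q powr (s + 1) = q * r powr (- ln q / ln \<alpha>)"
      using q r by (simp add: powr_add) (simp add: powr_def s_def mult.commute)
    finally show ?thesis by (simp add: mult_ac)
  qed
  moreover have "q * (real (card U) + 1) > 0" using q by simp
  ultimately show ?thesis unfolding q_def \<alpha>_def by blast
qed

end
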